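(* Let $(X_t)_{t\ge1}$ be a sequence of random variables such that, for constants $\mu,\sigma^2$ and all $t\ge 1$, $X_t\in[0,1]$, $\mathbb{E}_{t-1}X_t=\mu$ and $\mathbb{V}_{t-1}X_t=\sigma^2$. Let $\alpha\in(0,1)$ and $\alpha_1,\alpha_2>0$ with $\alpha_1+\alpha_2=\alpha$. Let $(\widehat\sigma_i^2)_{i\ge1}$ be any $[0,1]$-valued predictable sequence, $(\lambda_i)_{i\ge1}$ any $[0,1)$-valued predictable sequence and $(\tilde\lambda_i)_{i\ge1}$ any $[0,\infty)$-valued predictable sequence, and let $\widehat\mu_1=\frac12$ and $\widehat\mu_t=\frac{\sum_{i=1}^{t-1}\tilde\lambda_iX_i}{\sum_{i=1}^{t-1}\tilde\lambda_i}$ for $t\ge2$. Then the sequence of intervals $(L_t,\infty)$, $t\ge1$, is a $1-\alpha$ (lower) confidence sequence for $\sigma^2$, where $$L_t=\frac{-C^{(1)}_{t,\alpha_1}+\sqrt{\left(C^{(1)}_{t,\alpha_1}\right)^2+4C^{(2)}_t\left(D_t-C^{(0)}_{t,\alpha_1}-R_{t,\alpha_2}\right)}}{2C^{(2)}_t},$$ and the quantities $D_t$, $R_{t,\alpha_2}$, $C^{(0)}_{t,\alpha_1}$, $C^{(1)}_{t,\alpha_1}$, $C^{(2)}_t$ are those defined (from $X,\widehat\mu,\widehat\sigma,\lambda,\tilde\lambda$) in the context.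
   Context: All random variables live on a common probability space with probability $\mathbb{P}$. $\mathcal{F}_t=\sigma(X_1,\dots,X_t)$ is the canonical filtration, with $\mathcal{F}_0$ trivial; $\mathbb{E}_t[\cdot]=\mathbb{E}[\cdot\mid\mathcal{F}_t]$ and $\mathbb{V}_t[\cdot]=\mathbb{V}[\cdot\mid\mathcal{F}_t]$. Relations between random variables hold almost surely. A sequence $(M_i)_{i\ge1}$ is predictable if $M_i$ is $\mathcal{F}_{i-1}$-measurable for all $i\ge1$. A sequence of random sets $(C_t)_{t\ge1}$ is a $1-\alpha$ confidence sequence for $\theta$ if $\mathbb{P}(\forall t\ge1:\theta\in C_t)\ge1-\alpha$. $\psi_E(\lambda)=-\log(1-\lambda)-\lambda$ for $\lambda\in[0,1)$ and $\psi_P(\lambda)=\exp(\lambda)-\lambda-1$ for $\lambda\ge0$. Definitions: $$D_t=\frac{\sum_{i\le t}\lambda_i(X_i-\widehat\mu_i)^2}{\sum_{i\le t}\lambda_i},\qquad R_{t,\delta}=\frac{\log(1/\delta)+\sum_{i\le t}\psi_E(\lambda_i)\left((X_i-\widehat\mu_i)^2-\widehat\sigma_i^2\right)^2}{\sum_{i\le t}\lambda_i}.$$ For $t\ge2$, $$\tilde C^{(2)}_t=\frac{\left(\sum_{i=1}^{t-1}\psi_P(\tilde\lambda_i)\right)^2}{\left(\sum_{i=1}^{t-1}\tilde\lambda_i\right)^2},\quad \tilde C^{(1)}_{t,\delta}=\frac{2\log(2/\delta)\sum_{i=1}^{t-1}\psi_P(\tilde\lambda_i)}{\left(\sum_{i=1}^{t-1}\tilde\lambda_i\right)^2},\quad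 \tilde C^{(0)}_{t,\delta}=\frac{\log^2(2/\delta)}{\left(\sum_{i=1}^{t-1}\tilde\lambda_i\right)^2},$$ and $\tilde C^{(2)}_1=\tilde C^{(1)}_{1,\delta}=0$, $\tilde C^{(0)}_{1,\delta}=\frac14$. Then $$C^{(2)}_t=\frac{\sum_{i\le t}\lambda_i\tilde C^{(2)}_i}{\sum_{i\le t}\lambda_i},\quad C^{(1)}_{t,\delta}=1+\frac{\sum_{i\le t}\lambda_i\tilde C^{(1)}_{i,\delta}}{\sum_{i\le t}\lambda_i},\quad C^{(0)}_{t,\delta}=\frac{\sum_{i\le t}\lambda_i\tilde C^{(0)}_{i,\delta}}{\sum_{i\le t}\lambda_i}.$$ Conventions for degenerate cases: if $\sum_{i=1}^{t-1}\tilde\lambda_i=0$ for some $t\ge2$, then $\widehat\mu_t$ and the coefficients $\tilde C_t$ are given the same values as at $t=1$ (namely $\frac12$, and $0,0,\frac14$). If the expression for $L_t$ is not a well-defined real number (i.e. $\sum_{i\le t}\lambda_i=0$, or $C^{(2)}_t=0$, or the quantity under the square root is negative), then $L_t=-\infty$. *)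

theory Defs
  imports "HOL-Probability.Probability"
begin

text \<open>The canonical filtration of a process indexed from 1; at \<^term>\<open>t = (0::nat)\<close> the union is
  empty, so the generated sigma-algebra is trivial.\<close>

definition canonical_filtration :: "'a measure \<Rightarrow> (nat \<Rightarrow> 'a \<Rightarrow> real) \<Rightarrow> nat \<Rightarrow> 'a measure" where
  "canonical_filtration M X t =
     sigma (space M) (\<Union>i\<in>{1..t}. {X i -` A \<inter> space M | A. A \<in> sets borel})"

definition cond_var :: "'a measure \<Rightarrow> 'a measure \<Rightarrow> ('a \<Rightarrow> real) \<Rightarrow> 'a \<Rightarrow> real" where
  "cond_var M F Y = real_cond_exp M F (\<lambda>\<omega>. (Y \<omega> - real_cond_exp M F Y \<omega>)\<^sup>2)"

definition predictable :: "(nat \<Rightarrow> 'a measure) \<Rightarrow> (nat \<Rightarrow> 'a \<Rightarrow> real) \<Rightarrow> bool" where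
  "predictable F Y \<longleftrightarrow> (\<forall>i\<ge>1. Y i \<in> borel_measurable (F (i - 1)))"

text \<open>Since \<^const>\<open>measure\<close> is 0 on non-measurable sets, for \<open>\<alpha> < 1\<close> this includes
  that the coverage event is measurable.\<close>

definition confidence_sequence ::
    "'a measure \<Rightarrow> real \<Rightarrow> 'b \<Rightarrow> (nat \<Rightarrow> 'a \<Rightarrow> 'b set) \<Rightarrow> bool" where
  "confidence_sequence M \<alpha> \<theta> C \<longleftrightarrow>
     measure M {\<omega> \<in> space M. \<forall>t\<ge>1. \<theta> \<in> C t \<omega>} \<ge> 1 - \<alpha>"

definition psi_E :: "real \<Rightarrow> real" where
  "psi_E l = - ln (1 - l) - l"

definition psi_P :: "real \<Rightarrow> real" where
  "psi_P l = exp l - l - 1"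

text \<open>The following quantities are functions of realised real sequences: observations \<open>x\<close>,
  variance predictions \<open>s\<close> (these are the squared quantities), weights \<open>l\<close>, and weights \<open>lt\<close>
  (the ones with a tilde) for the mean estimate. Index 0 of a sequence is never used.\<close>

definition mu_hat :: "(nat \<Rightarrow> real) \<Rightarrow> (nat \<Rightarrow> real) \<Rightarrow> nat \<Rightarrow> real" where
  "mu_hat x lt t =
     (if t = 1 \<or> (\<Sum>i\<in>{1..<t}. lt i) = 0 then 1 / 2
      else (\<Sum>i\<in>{1..<t}. lt i * x i) / (\<Sum>i\<in>{1..<t}. lt i))"

definition D_stat :: "(nat \<Rightarrow> real) \<Rightarrow> (nat \<Rightarrow> real) \<Rightarrow> (nat \<Rightarrow> real) \<Rightarrow> nat \<Rightarrow> real" where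
  "D_stat x l lt t =
     (\<Sum>i\<in>{1..t}. l i * (x i - mu_hat x lt i)\<^sup>2) / (\<Sum>i\<in>{1..t}. l i)"

definition R_stat ::
    "(nat \<Rightarrow> real) \<Rightarrow> (nat \<Rightarrow> real) \<Rightarrow> (nat \<Rightarrow> real) \<Rightarrow> (nat \<Rightarrow> real) \<Rightarrow> real \<Rightarrow> nat \<Rightarrow> real" where
  "R_stat x s l lt \<delta> t =
     (ln (1 / \<delta>) + (\<Sum>i\<in>{1..t}. psi_E (l i) * ((x i - mu_hat x lt i)\<^sup>2 - s i)\<^sup>2))
       / (\<Sum>i\<in>{1..t}. l i)"

definition C2_tilde :: "(nat \<Rightarrow> real) \<Rightarrow> nat \<Rightarrow> real" where
  "C2_tilde lt t =
     (if t = 1 \<or> (\<Sum>i\<in>{1..<t}. lt i) = 0 then 0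
      else (\<Sum>i\<in>{1..<t}. psi_P (lt i))\<^sup>2 / (\<Sum>i\<in>{1..<t}. lt i)\<^sup>2)"

definition C1_tilde :: "(nat \<Rightarrow> real) \<Rightarrow> real \<Rightarrow> nat \<Rightarrow> real" where
  "C1_tilde lt \<delta> t =
     (if t = 1 \<or> (\<Sum>i\<in>{1..<t}. lt i) = 0 then 0
      else 2 * ln (2 / \<delta>) * (\<Sum>i\<in>{1..<t}. psi_P (lt i)) / (\<Sum>i\<in>{1..<t}. lt i)\<^sup>2)"

definition C0_tilde :: "(nat \<Rightarrow> real) \<Rightarrow> real \<Rightarrow> nat \<Rightarrow> real" where
  "C0_tilde lt \<delta> t =
     (if t = 1 \<or> (\<Sum>i\<in>{1..<t}. lt i) = 0 then 1 / 4
      else (ln (2 / \<delta>))\<^sup>2 / (\<Sum>i\<in>{1..<t}. lt i)\<^sup>2)"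

definition C2 :: "(nat \<Rightarrow> real) \<Rightarrow> (nat \<Rightarrow> real) \<Rightarrow> nat \<Rightarrow> real" where
  "C2 l lt t = (\<Sum>i\<in>{1..t}. l i * C2_tilde lt i) / (\<Sum>i\<in>{1..t}. l i)"

definition C1 :: "(nat \<Rightarrow> real) \<Rightarrow> (nat \<Rightarrow> real) \<Rightarrow> real \<Rightarrow> nat \<Rightarrow> real" where
  "C1 l lt \<delta> t = 1 + (\<Sum>i\<in>{1..t}. l i * C1_tilde lt \<delta> i) / (\<Sum>i\<in>{1..t}. l i)"

definition C0 :: "(nat \<Rightarrow> real) \<Rightarrow> (nat \<Rightarrow> real) \<Rightarrow> real \<Rightarrow> nat \<Rightarrow> real" where
  "C0 l lt \<delta> t = (\<Sum>i\<in>{1..t}. l i * C0_tilde lt \<delta> i) / (\<Sum>i\<in>{1..t}. l i)"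

definition L_radicand ::
    "real \<Rightarrow> real \<Rightarrow> (nat \<Rightarrow> real) \<Rightarrow> (nat \<Rightarrow> real) \<Rightarrow> (nat \<Rightarrow> real) \<Rightarrow> (nat \<Rightarrow> real) \<Rightarrow> nat \<Rightarrow> real" where
  "L_radicand \<alpha>1 \<alpha>2 x s l lt t =
     (C1 l lt \<alpha>1 t)\<^sup>2
       + 4 * C2 l lt t * (D_stat x l lt t - C0 l lt \<alpha>1 t - R_stat x s l lt \<alpha>2 t)"

definition L_bound ::
    "real \<Rightarrow> real \<Rightarrow> (nat \<Rightarrow> real) \<Rightarrow> (nat \<Rightarrow> real) \<Rightarrow> (nat \<Rightarrow> real) \<Rightarrow> (nat \<Rightarrow> real) \<Rightarrow> nat \<Rightarrow> ereal" where
  "L_bound \<alpha>1 \<alpha>2 x s l lt t =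
     (if (\<Sum>i\<in>{1..t}. l i) = 0 \<or> C2 l lt t = 0 \<or> L_radicand \<alpha>1 \<alpha>2 x s l lt t < 0 then - \<infinity>
      else ereal ((- C1 l lt \<alpha>1 t + sqrt (L_radicand \<alpha>1 \<alpha>2 x s l lt t)) / (2 * C2 l lt t)))"

end

theory Submission imports Defs begin

text \<open>
  The proof transfers two exponential supermartingale bounds into one quadratic inequality for the
  unknown variance. Write \<open>m\<^sub>i\<close> for the running estimate \<open>mu_hat\<close> of the mean. The squared
  residual \<open>(X\<^sub>i - m\<^sub>i)\<^sup>2\<close> has conditional mean \<open>\<sigma>2 + (m\<^sub>i - \<mu>)\<^sup>2\<close>, so a bound on how far the
  weighted sum of squared residuals exceeds the sum of these conditional means bounds \<open>\<sigma>2\<close> from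
  below, once the bias \<open>(m\<^sub>i - \<mu>)\<^sup>2\<close> is under control.

  For the squared residuals, the factors
  \<open>exp (l ((X - m)\<^sup>2 - \<sigma>2 - (m - \<mu>)\<^sup>2) - psi_E l ((X - m)\<^sup>2 - s)\<^sup>2)\<close> have conditional mean at most \<open>1\<close>,
  which gives an empirical Bernstein bound with error probability \<open>\<alpha>2\<close> (\<open>square_deviation\<close>). For the
  bias, the factors \<open>exp (\<plusminus> lt (X - \<mu>) - psi_P lt \<sigma>2)\<close> have conditional mean at most \<open>1\<close>, which
  gives a Bennett bound for each sign with error probability \<open>\<alpha>1 / 2\<close> (\<open>mean_deviation\<close>). The
  width of the latter is affine in \<open>\<sigma>2\<close>, so \<open>(m\<^sub>i - \<mu>)\<^sup>2\<close> is at most a quadratic polynomial in \<open>\<sigma>2\<close>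
  whose coefficients are the quantities \<open>C2_tilde\<close>, \<open>C1_tilde\<close> and \<open>C0_tilde\<close> (\<open>mu_hat_error\<close>).
  Both families of factors are dominated by a quadratic polynomial in \<open>X - \<mu>\<close> with predictable
  coefficients, so only the first two conditional moments of \<open>X\<close> enter
  (\<open>cond_exp_le_one_of_quadratic_bound\<close>), and the maximal inequality \<open>ville\<close> makes the bounds hold
  for all times at once.

  Outside the three exceptional events the two bounds combine into
  \<open>D - C0 - R < C2 \<sigma>2\<^sup>2 + C1 \<sigma>2\<close> at every time with positive total weight. When \<open>L_bound\<close> is
  finite, it is the larger root of the corresponding quadratic equation,
  so \<open>\<sigma>2\<close> lies strictly above it (\<open>L_bound_less\<close>). A union bound finishes the proof.
\<close>

section \<open>Two inequalities from power series\<close>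

text \<open>
  Both exponential inequalities below compare the remainder of a function after its linear term at
  \<open>l * x\<close> and at \<open>l\<close>. The comparison holds term by term, as \<open>x ^ k \<le> x\<^sup>2\<close> for \<open>k \<ge> 2\<close> and
  \<open>\<bar>x\<bar> \<le> 1\<close>.
\<close>

lemma nonneg_power_series_tail_le:
  fixes a :: "nat \<Rightarrow> real"
  assumes a: "\<And>k. a k \<ge> 0" and l: "l \<ge> 0" and x: "\<bar>x\<bar> \<le> 1"
    and s: "(\<lambda>k. a k * l ^ k) sums s" and s': "(\<lambda>k. a k * (l * x) ^ k) sums s'"
  shows "s' - a 0 - a 1 * (l * x) \<le> x\<^sup>2 * (s - a 0 - a 1 * l)"
proof -
  have 1: "(\<lambda>k. a (k + 2) * (l * x) ^ (k + 2)) sums (s' - a 0 - a 1 * (l * x))"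
    using sums_split_initial_segment[OF s', of 2] by (simp add: eval_nat_numeral algebra_simps)
  have "(\<lambda>k. a (k + 2) * l ^ (k + 2)) sums (s - a 0 - a 1 * l)"
    using sums_split_initial_segment[OF s, of 2] by (simp add: eval_nat_numeral algebra_simps)
  then have 2: "(\<lambda>k. x\<^sup>2 * (a (k + 2) * l ^ (k + 2))) sums (x\<^sup>2 * (s - a 0 - a 1 * l))"
    by (rule sums_mult)
  show ?thesis
  proof (rule sums_le[OF _ 1 2])
    fix k
    have "\<bar>x ^ k\<bar> \<le> 1"
      using x by (simp add: power_abs power_le_one)
    then have "x ^ k \<le> 1"
      by (rule abs_le_D1)
    then have "x\<^sup>2 * x ^ k \<le> x\<^sup>2 * 1"
      by (intro mult_left_mono) auto
    then have "x ^ (k + 2) \<le> x\<^sup>2"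
      by (simp only: power_add mult.commute mult_1_right)
    then have "(a (k + 2) * l ^ (k + 2)) * x ^ (k + 2) \<le> (a (k + 2) * l ^ (k + 2)) * x\<^sup>2"
      using a l by (intro mult_left_mono mult_nonneg_nonneg zero_le_power) auto
    then show "a (k + 2) * (l * x) ^ (k + 2) \<le> x\<^sup>2 * (a (k + 2) * l ^ (k + 2))"
      by (simp only: power_mult_distrib mult_ac)
  qed
qed

lemma exp_mult_le_psi_P:
  assumes "l \<ge> 0" and "\<bar>x\<bar> \<le> 1"
  shows "exp (l * x) \<le> 1 + l * x + psi_P l * x\<^sup>2"
proof -
  have "(\<lambda>k. (1 / fact k) * z ^ k) sums exp z" for z :: real
    using exp_converges[of z] by (simp add: divide_inverse mult.commute)
  from nonneg_power_series_tail_le[OF _ assms this this] show ?thesis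
    by (simp add: psi_P_def algebra_simps)
qed

text \<open>
  The logarithm of the claim is the tail comparison for the series of \<open>- ln (1 - z)\<close>, taken at the
  points \<open>l\<close> and \<open>l * (- x)\<close>; the remainder of that series after its linear term is \<open>psi_E\<close>.
\<close>

lemma exp_minus_psi_E_le:
  assumes l: "0 \<le> l" "l < 1" and x: "\<bar>x\<bar> \<le> 1"
  shows "exp (l * x - psi_E l * x\<^sup>2) \<le> 1 + l * x"
proof -
  have ser: "(\<lambda>k. (1 / real k) * z ^ k) sums (- ln (1 - z))" if "\<bar>z\<bar> < 1" for z :: real
    using sums_minus[OF ln_series'[of "- z"]] that by simp
  have "l * \<bar>x\<bar> \<le> l * 1"
    using l x by (intro mult_left_mono) auto
  then have lx: "\<bar>l * x\<bar> < 1"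
    using l by (simp add: abs_mult)
  have "- ln (1 - l * (- x)) - l * (- x) \<le> (- x)\<^sup>2 * (- ln (1 - l) - l)"
    using nonneg_power_series_tail_le[of "\<lambda>k. 1 / real k" l "- x", OF _ l(1) _ ser ser]
      l x lx by simp
  then have "l * x - psi_E l * x\<^sup>2 \<le> ln (1 + l * x)"
    by (simp add: psi_E_def algebra_simps)
  then have "exp (l * x - psi_E l * x\<^sup>2) \<le> exp (ln (1 + l * x))"
    by simp
  moreover have "0 < 1 + l * x"
    using lx by linarith
  ultimately show ?thesis
    by simp
qed

lemma psi_P_nonneg: "psi_P l \<ge> 0"
  using exp_ge_add_one_self[of l] unfolding psi_P_def by linarith

section \<open>A maximal inequality for nonnegative supermartingales\<close>

text \<open>
  This is the relation \<open>E[Z | G] \<le> 1\<close> for nonnegative \<open>Z\<close>, tested against all finite nonnegative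
  \<open>G\<close>-measurable weights. Stating it with nonnegative integrals allows weights that are unbounded or
  fail to be integrable, such as products of exponential factors.
\<close>

definition cond_exp_le_one :: "'a measure \<Rightarrow> 'a measure \<Rightarrow> ('a \<Rightarrow> real) \<Rightarrow> bool" where
  "cond_exp_le_one M G Z \<longleftrightarrow>
     (\<forall>W \<in> borel_measurable G. (\<forall>\<omega>. 0 \<le> W \<omega>) \<longrightarrow>
        (\<integral>\<^sup>+ \<omega>. ennreal (W \<omega> * Z \<omega>) \<partial>M) \<le> (\<integral>\<^sup>+ \<omega>. ennreal (W \<omega>) \<partial>M))"

text \<open>
  The proof follows the process that is frozen at the value \<open>c\<close> from the first time at which
  the product reaches \<open>c\<close>; at time \<open>t\<close> this is \<open>J t\<close> below. Its expectation does not increase: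
  on the paths that have not reached the level the next factor has conditional mean at most \<open>1\<close>, and
  where the level is then reached, freezing at \<open>c\<close> can only lower the value. Markov's inequality bounds the probability of having reached \<open>c\<close> by
  time \<open>t\<close>, and \<open>t\<close> tends to infinity.
\<close>

lemma (in prob_space) ville:
  fixes Z :: "nat \<Rightarrow> 'a \<Rightarrow> real" and G :: "nat \<Rightarrow> 'a measure"
  assumes sub: "\<And>t. subalgebra M (G t)" and mono: "\<And>s t. s \<le> t \<Longrightarrow> subalgebra (G t) (G s)"
    and Zm: "\<And>t. t \<ge> 1 \<Longrightarrow> Z t \<in> borel_measurable (G t)" and Z0: "\<And>t \<omega>. Z t \<omega> \<ge> 0"
    and step: "\<And>t. t \<ge> 1 \<Longrightarrow> cond_exp_le_one M (G (t - 1)) (Z t)"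
    and c: "c > 0"
  shows "{\<omega> \<in> space M. \<exists>t. c \<le> (\<Prod>i\<in>{1..t}. Z i \<omega>)} \<in> events"
    and "prob {\<omega> \<in> space M. \<exists>t. c \<le> (\<Prod>i\<in>{1..t}. Z i \<omega>)} \<le> 1 / c"
proof -
  define P where "P t \<omega> = (\<Prod>i\<in>{1..t}. Z i \<omega>)" for t \<omega>
  define A where "A t = {\<omega> \<in> space M. \<exists>s\<le>t. c \<le> P s \<omega>}" for t
  have P0: "P t \<omega> \<ge> 0" for t \<omega>
    by (simp add: P_def prod_nonneg Z0)
  have Z_later: "Z i \<in> borel_measurable (G t)" if "1 \<le> i" "i \<le> t" for i t
    using measurable_from_subalg[OF mono[OF that(2)] Zm[OF that(1)]] .
  have P_later: "P s \<in> borel_measurable (G t)" if "s \<le> t" for s t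
    unfolding P_def using that by (intro borel_measurable_prod Z_later) auto
  have sp: "space (G t) = space M" for t
    using sub by (simp add: subalgebra_def)
  have AG: "A t \<in> sets (G t)" for t
  proof -
    have "{\<omega> \<in> space (G t). c \<le> P s \<omega>} \<in> sets (G t)" if "s \<le> t" for s
      using P_later[OF that] by measurable
    then have "(\<Union>s\<in>{..t}. {\<omega> \<in> space (G t). c \<le> P s \<omega>}) \<in> sets (G t)"
      by (intro sets.finite_UN) auto
    also have "(\<Union>s\<in>{..t}. {\<omega> \<in> space (G t). c \<le> P s \<omega>}) = A t"
      by (auto simp: A_def sp)
    finally show ?thesis .
  qed
  then have AM[measurable]: "A t \<in> events" for t
    using sub by (auto simp: subalgebra_def)
  have PM[measurable]: "P t \<in> borel_measurable M" for t
    using measurable_from_subalg[OF sub P_later[OF order_refl]] .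
  \<comment> \<open>\<open>W t\<close> is the product restricted to the paths that have stayed below \<open>c\<close>; it depends on the
    past only, so it is an admissible weight for the factor at time \<open>t + 1\<close>.\<close>
  define W where "W t \<omega> = P t \<omega> * indicator (- A t) \<omega>" for t \<omega>
  define J where "J t \<omega> = c * indicator (A t) \<omega> + W t \<omega>" for t \<omega>
  have WG: "W t \<in> borel_measurable (G t)" for t
  proof -
    have [measurable]: "P t \<in> borel_measurable (G t)" "A t \<in> sets (G t)"
      using P_later AG by auto
    show ?thesis
      unfolding W_def by measurable
  qed
  have W0: "W t \<omega> \<ge> 0" for t \<omega>
    by (simp add: W_def P0)
  have WM[measurable]: "W t \<in> borel_measurable M" for t
    using measurable_from_subalg[OF sub WG] .
  have ZM[measurable]: "Z (Suc t) \<in> borel_measurable M" for t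
    using measurable_from_subalg[OF sub Zm] by auto
  have JM[measurable]: "J t \<in> borel_measurable M" for t
    unfolding J_def by measurable
  have P_Suc: "P (Suc t) \<omega> = P t \<omega> * Z (Suc t) \<omega>" for t \<omega>
    by (simp add: P_def)
  have J_le: "J (Suc t) \<omega> \<le> c * indicator (A t) \<omega> + W t \<omega> * Z (Suc t) \<omega>"
    if "\<omega> \<in> space M" for t \<omega>
  proof -
    consider "\<omega> \<in> A t" | "\<omega> \<notin> A t" "\<omega> \<in> A (Suc t)" | "\<omega> \<notin> A (Suc t)" "\<omega> \<notin> A t"
      by blast
    then show ?thesis
    proof cases
      case 1
      then have "\<omega> \<in> A (Suc t)"
        by (auto simp: A_def intro: le_SucI)
      with 1 show ?thesis
        by (simp add: J_def W_def)
    next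
      case 2
      then have "c \<le> P (Suc t) \<omega>"
        by (auto simp: A_def le_Suc_eq)
      with 2 show ?thesis
        by (simp add: J_def W_def P_Suc)
    next
      case 3
      then show ?thesis
        by (simp add: J_def W_def P_Suc)
    qed
  qed
  have J_int: "(\<integral>\<^sup>+\<omega>. ennreal (J t \<omega>) \<partial>M) \<le> 1" for t
  proof (induction t)
    case 0
    have "(\<integral>\<^sup>+\<omega>. ennreal (J 0 \<omega>) \<partial>M) \<le> (\<integral>\<^sup>+\<omega>. ennreal 1 \<partial>M)"
      by (intro nn_integral_mono ennreal_leI)
        (auto simp: J_def W_def A_def P_def indicator_def)
    then show ?case
      by (simp add: emeasure_space_1)
  next
    case (Suc t)
    have "(\<integral>\<^sup>+\<omega>. ennreal (J (Suc t) \<omega>) \<partial>M)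
        \<le> (\<integral>\<^sup>+\<omega>. ennreal (c * indicator (A t) \<omega>) + ennreal (W t \<omega> * Z (Suc t) \<omega>) \<partial>M)"
      using J_le c W0 Z0
      by (intro nn_integral_mono)
        (auto simp: ennreal_plus[symmetric] simp del: ennreal_plus intro!: ennreal_leI)
    also have "\<dots> = (\<integral>\<^sup>+\<omega>. ennreal (c * indicator (A t) \<omega>) \<partial>M)
        + (\<integral>\<^sup>+\<omega>. ennreal (W t \<omega> * Z (Suc t) \<omega>) \<partial>M)"
      by (intro nn_integral_add) auto
    also have "\<dots> \<le> (\<integral>\<^sup>+\<omega>. ennreal (c * indicator (A t) \<omega>) \<partial>M)
        + (\<integral>\<^sup>+\<omega>. ennreal (W t \<omega>) \<partial>M)"
      using step[of "Suc t"] WG[of t] W0 by (intro add_left_mono) (auto simp: cond_exp_le_one_def)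
    also have "\<dots> = (\<integral>\<^sup>+\<omega>. ennreal (J t \<omega>) \<partial>M)"
      using c W0 by (subst nn_integral_add[symmetric]) (auto simp: J_def)
    finally show ?case
      using Suc.IH by order
  qed
  have prob_A: "prob (A t) \<le> 1 / c" for t
  proof -
    have "ennreal c * emeasure M (A t) = (\<integral>\<^sup>+\<omega>. ennreal c * indicator (A t) \<omega> \<partial>M)"
      by (simp add: nn_integral_cmult_indicator)
    also have "\<dots> \<le> (\<integral>\<^sup>+\<omega>. ennreal (J t \<omega>) \<partial>M)"
      using c W0 by (intro nn_integral_mono) (auto simp: J_def indicator_def intro!: ennreal_leI)
    also have "\<dots> \<le> 1"
      by (rule J_int)
    finally have "c * prob (A t) \<le> 1"
      using c by (simp add: emeasure_eq_measure ennreal_mult[symmetric])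
    then show ?thesis
      using c by (simp add: field_simps)
  qed
  have eq: "{\<omega> \<in> space M. \<exists>t. c \<le> (\<Prod>i\<in>{1..t}. Z i \<omega>)} = (\<Union>t. A t)"
    by (auto simp: A_def P_def)
  show "{\<omega> \<in> space M. \<exists>t. c \<le> (\<Prod>i\<in>{1..t}. Z i \<omega>)} \<in> events"
    unfolding eq by auto
  have "incseq A"
    by (rule incseq_SucI) (auto simp: A_def intro: le_SucI)
  then have "(\<lambda>t. prob (A t)) \<longlonglongrightarrow> prob (\<Union>t. A t)"
    by (intro finite_Lim_measure_incseq) auto
  then show "prob {\<omega> \<in> space M. \<exists>t. c \<le> (\<Prod>i\<in>{1..t}. Z i \<omega>)} \<le> 1 / c"
    unfolding eq by (rule LIMSEQ_le_const2) (use prob_A in auto)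
qed

lemma (in prob_space) ville_exp:
  fixes U :: "nat \<Rightarrow> 'a \<Rightarrow> real" and G :: "nat \<Rightarrow> 'a measure"
  assumes "\<And>t. subalgebra M (G t)" and "\<And>s t. s \<le> t \<Longrightarrow> subalgebra (G t) (G s)"
    and Um: "\<And>t. t \<ge> 1 \<Longrightarrow> U t \<in> borel_measurable (G t)"
    and "\<And>t. t \<ge> 1 \<Longrightarrow> cond_exp_le_one M (G (t - 1)) (\<lambda>\<omega>. exp (U t \<omega>))"
    and \<delta>: "\<delta> > 0"
  shows "{\<omega> \<in> space M. \<exists>t. ln (1 / \<delta>) \<le> (\<Sum>i\<in>{1..t}. U i \<omega>)} \<in> events"
    and "prob {\<omega> \<in> space M. \<exists>t. ln (1 / \<delta>) \<le> (\<Sum>i\<in>{1..t}. U i \<omega>)} \<le> \<delta>"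
proof -
  have meas: "(\<lambda>\<omega>. exp (U t \<omega>)) \<in> borel_measurable (G t)" if "t \<ge> 1" for t
    using Um[OF that] by measurable
  have iff: "ln (1 / \<delta>) \<le> (\<Sum>i\<in>{1..t}. U i \<omega>) \<longleftrightarrow> 1 / \<delta> \<le> (\<Prod>i\<in>{1..t}. exp (U i \<omega>))" for t \<omega>
  proof -
    have "ln (1 / \<delta>) \<le> (\<Sum>i\<in>{1..t}. U i \<omega>) \<longleftrightarrow> exp (ln (1 / \<delta>)) \<le> exp (\<Sum>i\<in>{1..t}. U i \<omega>)"
      by (simp only: exp_le_cancel_iff)
    then show ?thesis
      using \<delta> by (simp add: exp_sum)
  qed
  note v = ville[of G "\<lambda>t \<omega>. exp (U t \<omega>)" "1 / \<delta>", OF assms(1,2) meas _ assms(4)]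
  show "{\<omega> \<in> space M. \<exists>t. ln (1 / \<delta>) \<le> (\<Sum>i\<in>{1..t}. U i \<omega>)} \<in> events"
    unfolding iff using \<delta> by (intro v(1)) auto
  have "prob {\<omega> \<in> space M. \<exists>t. 1 / \<delta> \<le> (\<Prod>i\<in>{1..t}. exp (U i \<omega>))} \<le> 1 / (1 / \<delta>)"
    using \<delta> by (intro v(2)) auto
  then show "prob {\<omega> \<in> space M. \<exists>t. ln (1 / \<delta>) \<le> (\<Sum>i\<in>{1..t}. U i \<omega>)} \<le> \<delta>"
    unfolding iff by simp
qed

section \<open>Processes with constant conditional mean and variance\<close>

locale constant_moments = prob_space M for M :: "'a measure" +
  fixes X :: "nat \<Rightarrow> 'a \<Rightarrow> real" and \<mu> v :: real
  assumes X_measurable: "\<And>t. t \<ge> 1 \<Longrightarrow> X t \<in> borel_measurable M"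
    and X_unit: "\<And>t. t \<ge> 1 \<Longrightarrow> AE \<omega> in M. X t \<omega> \<in> {0..1}"
    and cond_mean: "\<And>t. t \<ge> 1 \<Longrightarrow>
      AE \<omega> in M. real_cond_exp M (canonical_filtration M X (t - 1)) (X t) \<omega> = \<mu>"
    and cond_variance: "\<And>t. t \<ge> 1 \<Longrightarrow>
      AE \<omega> in M. cond_var M (canonical_filtration M X (t - 1)) (X t) \<omega> = v"
begin

abbreviation F :: "nat \<Rightarrow> 'a measure" where
  "F \<equiv> canonical_filtration M X"

lemma generators_Pow:
  "(\<Union>i\<in>{1..t}. {X i -` A \<inter> space M | A. A \<in> sets borel}) \<subseteq> Pow (space M)"
  by auto

lemma space_F: "space (F t) = space M"
  unfolding canonical_filtration_def by (rule space_measure_of[OF generators_Pow])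

lemma sets_F:
  "sets (F t) =
    sigma_sets (space M) (\<Union>i\<in>{1..t}. {X i -` A \<inter> space M | A. A \<in> sets borel})"
  unfolding canonical_filtration_def by (rule sets_measure_of[OF generators_Pow])

lemma F_subalgebra: "subalgebra M (F t)"
proof -
  have "(\<Union>i\<in>{1..t}. {X i -` A \<inter> space M | A. A \<in> sets borel}) \<subseteq> sets M"
    using X_measurable by (auto intro!: measurable_sets[of _ M borel])
  then show ?thesis
    by (simp add: subalgebra_def space_F sets_F sets.sigma_sets_subset)
qed

lemma F_mono:
  assumes "s \<le> t"
  shows "subalgebra (F t) (F s)"
proof -
  have "{1..s} \<subseteq> {1..t}"
    using assms by auto
  then have "sets (F s) \<subseteq> sets (F t)"
    unfolding sets_F by (intro sigma_sets_mono' UN_mono) auto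
  then show ?thesis
    by (simp add: subalgebra_def space_F)
qed

lemma X_adapted:
  assumes "1 \<le> i" "i \<le> t"
  shows "X i \<in> borel_measurable (F t)"
proof (rule measurableI)
  fix A :: "real set" assume "A \<in> sets borel"
  then show "X i -` A \<inter> space (F t) \<in> sets (F t)"
    using assms unfolding space_F sets_F by (intro sigma_sets.Basic UN_I[of i]) auto
qed simp

lemma F_measurable_mono: "f \<in> borel_measurable (F s) \<Longrightarrow> s \<le> t \<Longrightarrow> f \<in> borel_measurable (F t)"
  using measurable_from_subalg[OF F_mono] .

lemma F_measurable: "f \<in> borel_measurable (F t) \<Longrightarrow> f \<in> borel_measurable M"
  using measurable_from_subalg[OF F_subalgebra] .

lemma F_sigma_finite: "sigma_finite_subalgebra M (F t)"
proof -
  interpret finite_measure_subalgebra M "F t"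
    by unfold_locales (rule F_subalgebra)
  show ?thesis
    by unfold_locales
qed

lemma X_integrable:
  assumes "t \<ge> 1"
  shows "integrable M (X t)"
  using X_unit[OF assms] X_measurable[OF assms]
  by (intro integrable_const_bound[where B = 1]) auto

lemma mean_in_unit: "\<mu> \<in> {0..1}"
proof -
  interpret sigma_finite_subalgebra M "F 0"
    by (rule F_sigma_finite)
  have int: "integrable M (X 1)"
    by (simp add: X_integrable)
  have X1: "AE \<omega> in M. 0 \<le> X 1 \<omega>" "AE \<omega> in M. X 1 \<omega> \<le> 1"
    using X_unit[of 1] by auto
  have "AE \<omega> in M. real_cond_exp M (F 0) (X 1) \<omega> \<ge> 0" "AE \<omega> in M. real_cond_exp M (F 0) (X 1) \<omega> \<le> 1"
    using real_cond_exp_ge_c[OF int X1(1)] real_cond_exp_le_c[OF int X1(2)] by auto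
  moreover have "AE \<omega> in M. real_cond_exp M (F 0) (X 1) \<omega> = \<mu>"
    using cond_mean[of 1] by simp
  ultimately have "AE \<omega> in M. \<mu> \<in> {0..1}"
    by eventually_elim auto
  then show ?thesis
    by simp
qed

lemma X_centred_bound:
  assumes "t \<ge> 1"
  shows "AE \<omega> in M. \<bar>X t \<omega> - \<mu>\<bar> \<le> 1"
  using X_unit[OF assms] mean_in_unit by (auto simp: abs_le_iff)

lemma variance_nonneg: "v \<ge> 0"
proof -
  interpret sigma_finite_subalgebra M "F 0"
    by (rule F_sigma_finite)
  have [measurable]: "X 1 \<in> borel_measurable M"
    by (rule X_measurable) simp
  have sq: "(\<lambda>\<omega>. (X 1 \<omega> - real_cond_exp M (F 0) (X 1) \<omega>)\<^sup>2) \<in> borel_measurable M"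
    by measurable
  have "AE \<omega> in M. cond_var M (F 0) (X 1) \<omega> \<ge> 0"
    unfolding cond_var_def by (rule real_cond_exp_pos[OF _ sq]) simp
  moreover have "AE \<omega> in M. cond_var M (F 0) (X 1) \<omega> = v"
    using cond_variance[of 1] by simp
  ultimately have "AE \<omega> in M. 0 \<le> v"
    by eventually_elim simp
  then show ?thesis
    by simp
qed

lemma cond_exp_square:
  assumes "t \<ge> 1"
  shows "AE \<omega> in M. real_cond_exp M (F (t - 1)) (\<lambda>\<omega>. (X t \<omega> - \<mu>)\<^sup>2) \<omega> = v"
proof -
  interpret sigma_finite_subalgebra M "F (t - 1)"
    by (rule F_sigma_finite)
  note [measurable] = X_measurable[OF assms]
  have "AE \<omega> in M. real_cond_exp M (F (t - 1)) (\<lambda>\<omega>. (X t \<omega> - \<mu>)\<^sup>2) \<omega>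
      = cond_var M (F (t - 1)) (X t) \<omega>"
    unfolding cond_var_def using cond_mean[OF assms] by (intro real_cond_exp_cong) auto
  then show ?thesis
    using cond_variance[OF assms] by auto
qed

lemma bounded_times_integrable:
  fixes f g :: "'a \<Rightarrow> real"
  assumes "f \<in> borel_measurable M" "g \<in> borel_measurable M"
    and "\<And>\<omega>. \<bar>f \<omega>\<bar> \<le> c" and "AE \<omega> in M. \<bar>g \<omega>\<bar> \<le> 1"
  shows "integrable M (\<lambda>\<omega>. f \<omega> * g \<omega>)"
proof (rule integrable_const_bound[where B = c])
  show "AE \<omega> in M. norm (f \<omega> * g \<omega>) \<le> c"
    using assms(4)
  proof eventually_elim
    case (elim \<omega>)
    then have "\<bar>f \<omega>\<bar> * \<bar>g \<omega>\<bar> \<le> c * 1"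
      using assms(3)[of \<omega>] by (intro mult_mono) auto
    then show ?case
      by (simp add: abs_mult)
  qed
qed (use assms(1,2) in measurable)

text \<open>
  With bounded predictable coefficients, taking out what is known replaces \<open>X - \<mu>\<close> by \<open>0\<close> and its
  square by \<open>v\<close>.
\<close>

lemma integral_quadratic:
  assumes t: "t \<ge> 1"
    and FM: "A \<in> borel_measurable (F (t - 1))" "B \<in> borel_measurable (F (t - 1))"
      "C \<in> borel_measurable (F (t - 1))"
    and bd: "\<And>\<omega>. \<bar>A \<omega>\<bar> \<le> c" "\<And>\<omega>. \<bar>B \<omega>\<bar> \<le> c" "\<And>\<omega>. \<bar>C \<omega>\<bar> \<le> c"
  shows "integrable M (\<lambda>\<omega>. A \<omega> + B \<omega> * (X t \<omega> - \<mu>) + C \<omega> * (X t \<omega> - \<mu>)\<^sup>2)"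
    and "(\<integral>\<omega>. A \<omega> + B \<omega> * (X t \<omega> - \<mu>) + C \<omega> * (X t \<omega> - \<mu>)\<^sup>2 \<partial>M)
      = (\<integral>\<omega>. A \<omega> + C \<omega> * v \<partial>M)"
proof -
  interpret sigma_finite_subalgebra M "F (t - 1)"
    by (rule F_sigma_finite)
  note [measurable] = X_measurable[OF t] FM[THEN F_measurable]
  have iA: "integrable M A" and iC: "integrable M C"
    using bd by (auto intro!: integrable_const_bound[where B = c])
  have iB: "integrable M (\<lambda>\<omega>. B \<omega> * X t \<omega>)"
    using X_unit[OF t] bd by (intro bounded_times_integrable[where c = c]) auto
  have iB1: "integrable M (\<lambda>\<omega>. B \<omega> * \<mu>)"
    using mean_in_unit bd by (intro bounded_times_integrable[where c = c]) auto
  have iC2: "integrable M (\<lambda>\<omega>. C \<omega> * (X t \<omega> - \<mu>)\<^sup>2)"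
    using X_centred_bound[OF t] bd
    by (intro bounded_times_integrable[where c = c]) (auto simp: abs_square_le_1)
  have "(\<integral>\<omega>. B \<omega> * X t \<omega> \<partial>M) = (\<integral>\<omega>. B \<omega> * real_cond_exp M (F (t - 1)) (X t) \<omega> \<partial>M)"
    using FM by (intro real_cond_exp_intg(2)[symmetric] iB) auto
  also have "\<dots> = (\<integral>\<omega>. B \<omega> * \<mu> \<partial>M)"
    using cond_mean[OF t] FM[THEN F_measurable] by (intro integral_cong_AE) auto
  finally have eB: "(\<integral>\<omega>. B \<omega> * X t \<omega> \<partial>M) = (\<integral>\<omega>. B \<omega> * \<mu> \<partial>M)" .
  have "(\<integral>\<omega>. C \<omega> * (X t \<omega> - \<mu>)\<^sup>2 \<partial>M)
      = (\<integral>\<omega>. C \<omega> * real_cond_exp M (F (t - 1)) (\<lambda>\<omega>. (X t \<omega> - \<mu>)\<^sup>2) \<omega> \<partial>M)"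
    using FM by (intro real_cond_exp_intg(2)[symmetric] iC2) auto
  also have "\<dots> = (\<integral>\<omega>. C \<omega> * v \<partial>M)"
    using cond_exp_square[OF t] FM[THEN F_measurable] by (intro integral_cong_AE) auto
  finally have eC: "(\<integral>\<omega>. C \<omega> * (X t \<omega> - \<mu>)\<^sup>2 \<partial>M) = (\<integral>\<omega>. C \<omega> * v \<partial>M)" .
  have split: "A \<omega> + B \<omega> * (X t \<omega> - \<mu>) + C \<omega> * (X t \<omega> - \<mu>)\<^sup>2
      = A \<omega> + (B \<omega> * X t \<omega> - B \<omega> * \<mu>) + C \<omega> * (X t \<omega> - \<mu>)\<^sup>2" for \<omega>
    by (simp add: algebra_simps)
  show "integrable M (\<lambda>\<omega>. A \<omega> + B \<omega> * (X t \<omega> - \<mu>) + C \<omega> * (X t \<omega> - \<mu>)\<^sup>2)"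
    unfolding split using iA iB iB1 iC2 by auto
  show "(\<integral>\<omega>. A \<omega> + B \<omega> * (X t \<omega> - \<mu>) + C \<omega> * (X t \<omega> - \<mu>)\<^sup>2 \<partial>M)
      = (\<integral>\<omega>. A \<omega> + C \<omega> * v \<partial>M)"
    unfolding split using iA iB iB1 iC iC2 eB eC by simp
qed

text \<open>
  Formally, \<open>E[Z | F] \<le> A + B E[X - \<mu> | F] + C E[(X - \<mu>)\<^sup>2 | F] = A + C v \<le> 1\<close>. The coefficients
  and the weight may be unbounded, and the linear term has no sign, so these integrals need not
  exist; the argument is therefore carried out on the sets, known in advance, where the
  weight and its products with the coefficients are at most \<open>n\<close> in modulus, and Fatou's lemma
  removes the truncation.
\<close>

lemma cond_exp_le_one_of_quadratic_bound:
  assumes t: "t \<ge> 1"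
    and FM: "A \<in> borel_measurable (F (t - 1))" "B \<in> borel_measurable (F (t - 1))"
      "C \<in> borel_measurable (F (t - 1))"
    and Zm: "Z \<in> borel_measurable M" and Z0: "\<And>\<omega>. 0 \<le> Z \<omega>"
    and Z_le: "AE \<omega> in M. Z \<omega> \<le> A \<omega> + B \<omega> * (X t \<omega> - \<mu>) + C \<omega> * (X t \<omega> - \<mu>)\<^sup>2"
    and AC: "AE \<omega> in M. A \<omega> + C \<omega> * v \<le> 1"
  shows "cond_exp_le_one M (F (t - 1)) Z"
  unfolding cond_exp_le_one_def
proof (intro ballI impI)
  fix W :: "'a \<Rightarrow> real"
  assume W: "W \<in> borel_measurable (F (t - 1))" and W0: "\<forall>\<omega>. 0 \<le> W \<omega>"
  \<comment> \<open>the indicator of the truncation set at level \<open>n\<close>; it belongs to the \<open>\<sigma>\<close>-algebra of the past\<close>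
  define I :: "nat \<Rightarrow> 'a \<Rightarrow> real" where
    "I n \<omega> = (if \<bar>W \<omega>\<bar> \<le> real n \<and> \<bar>W \<omega> * A \<omega>\<bar> \<le> real n \<and> \<bar>W \<omega> * B \<omega>\<bar> \<le> real n
        \<and> \<bar>W \<omega> * C \<omega>\<bar> \<le> real n then 1 else 0)" for n \<omega>
  have IF: "I n \<in> borel_measurable (F (t - 1))" for n
    unfolding I_def using FM W by measurable
  note [measurable] = Zm X_measurable[OF t] FM[THEN F_measurable] W[THEN F_measurable]
    IF[THEN F_measurable]
  have I01: "0 \<le> I n \<omega>" "I n \<omega> \<le> 1" for n \<omega>
    by (auto simp: I_def)
  let ?q = "\<lambda>n \<omega>. (I n \<omega> * (W \<omega> * A \<omega>)) + (I n \<omega> * (W \<omega> * B \<omega>)) * (X t \<omega> - \<mu>)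
      + (I n \<omega> * (W \<omega> * C \<omega>)) * (X t \<omega> - \<mu>)\<^sup>2"
  have bounded_step: "(\<integral>\<^sup>+ \<omega>. ennreal (I n \<omega> * (W \<omega> * Z \<omega>)) \<partial>M) \<le> (\<integral>\<^sup>+ \<omega>. ennreal (W \<omega>) \<partial>M)" for n
  proof -
    have m: "(\<lambda>\<omega>. I n \<omega> * (W \<omega> * A \<omega>)) \<in> borel_measurable (F (t - 1))"
      "(\<lambda>\<omega>. I n \<omega> * (W \<omega> * B \<omega>)) \<in> borel_measurable (F (t - 1))"
      "(\<lambda>\<omega>. I n \<omega> * (W \<omega> * C \<omega>)) \<in> borel_measurable (F (t - 1))"
      using IF FM W by measurable
    have b: "\<bar>I n \<omega> * (W \<omega> * A \<omega>)\<bar> \<le> real n" "\<bar>I n \<omega> * (W \<omega> * B \<omega>)\<bar> \<le> real n"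
      "\<bar>I n \<omega> * (W \<omega> * C \<omega>)\<bar> \<le> real n" "\<bar>I n \<omega> * W \<omega>\<bar> \<le> real n" for \<omega>
      by (auto simp: I_def)
    note q = integral_quadratic[OF t m b(1,2,3)]
    have le: "AE \<omega> in M. I n \<omega> * (W \<omega> * Z \<omega>) \<le> ?q n \<omega>"
      using Z_le
    proof eventually_elim
      case (elim \<omega>)
      then have "(I n \<omega> * W \<omega>) * Z \<omega>
          \<le> (I n \<omega> * W \<omega>) * (A \<omega> + B \<omega> * (X t \<omega> - \<mu>) + C \<omega> * (X t \<omega> - \<mu>)\<^sup>2)"
        using I01 W0 by (intro mult_left_mono) auto
      then show ?case
        by (simp add: algebra_simps)
    qed
    have "(\<integral>\<^sup>+ \<omega>. ennreal (I n \<omega> * (W \<omega> * Z \<omega>)) \<partial>M) \<le> (\<integral>\<^sup>+ \<omega>. ennreal (?q n \<omega>) \<partial>M)"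
      using le by (intro nn_integral_mono_AE) (auto intro: ennreal_leI)
    also have "\<dots> = ennreal (\<integral>\<omega>. ?q n \<omega> \<partial>M)"
    proof (rule nn_integral_eq_integral[OF q(1)])
      show "AE \<omega> in M. 0 \<le> ?q n \<omega>"
        using le
      proof eventually_elim
        case (elim \<omega>)
        have "0 \<le> I n \<omega> * (W \<omega> * Z \<omega>)"
          using I01 W0 Z0 by simp
        then show ?case
          using elim by linarith
      qed
    qed
    also have "\<dots> = ennreal (\<integral>\<omega>. I n \<omega> * (W \<omega> * A \<omega>) + I n \<omega> * (W \<omega> * C \<omega>) * v \<partial>M)"
      unfolding q(2) ..
    also have "\<dots> \<le> ennreal (\<integral>\<omega>. I n \<omega> * W \<omega> \<partial>M)"
    proof (intro ennreal_leI integral_mono_AE)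
      show "integrable M (\<lambda>\<omega>. I n \<omega> * (W \<omega> * A \<omega>) + I n \<omega> * (W \<omega> * C \<omega>) * v)"
        using b by (intro Bochner_Integration.integrable_add integrable_mult_left
            integrable_const_bound[where B = "real n"]) auto
      show "integrable M (\<lambda>\<omega>. I n \<omega> * W \<omega>)"
        using b by (intro integrable_const_bound[where B = "real n"]) auto
      show "AE \<omega> in M. I n \<omega> * (W \<omega> * A \<omega>) + I n \<omega> * (W \<omega> * C \<omega>) * v \<le> I n \<omega> * W \<omega>"
        using AC
      proof eventually_elim
        case (elim \<omega>)
        then have "(I n \<omega> * W \<omega>) * (A \<omega> + C \<omega> * v) \<le> (I n \<omega> * W \<omega>) * 1"
          using I01 W0 by (intro mult_left_mono) auto
        then show ?case
          by (simp add: algebra_simps)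
      qed
    qed
    also have "\<dots> = (\<integral>\<^sup>+ \<omega>. ennreal (I n \<omega> * W \<omega>) \<partial>M)"
      using b I01 W0
      by (intro nn_integral_eq_integral[symmetric] integrable_const_bound[where B = "real n"]) auto
    also have "\<dots> \<le> (\<integral>\<^sup>+ \<omega>. ennreal (W \<omega>) \<partial>M)"
      using I01 W0 by (intro nn_integral_mono ennreal_leI) (auto intro: mult_left_le_one_le)
    finally show ?thesis .
  qed
  have lim: "(\<lambda>n. ennreal (I n \<omega> * (W \<omega> * Z \<omega>))) \<longlonglongrightarrow> ennreal (W \<omega> * Z \<omega>)" for \<omega>
  proof (rule tendsto_eventually)
    let ?c = "\<bar>W \<omega>\<bar> + \<bar>W \<omega> * A \<omega>\<bar> + \<bar>W \<omega> * B \<omega>\<bar> + \<bar>W \<omega> * C \<omega>\<bar>"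
    obtain N where N: "?c \<le> real N"
      using real_arch_simple by blast
    show "\<forall>\<^sub>F n in sequentially. ennreal (I n \<omega> * (W \<omega> * Z \<omega>)) = ennreal (W \<omega> * Z \<omega>)"
      using eventually_ge_at_top[of N]
    proof eventually_elim
      case (elim n)
      then have "?c \<le> real n"
        using N by linarith
      then have "I n \<omega> = 1"
        unfolding I_def by (smt (verit, best) abs_ge_zero)
      then show ?case
        by simp
    qed
  qed
  have "(\<integral>\<^sup>+ \<omega>. ennreal (W \<omega> * Z \<omega>) \<partial>M)
      = (\<integral>\<^sup>+ \<omega>. liminf (\<lambda>n. ennreal (I n \<omega> * (W \<omega> * Z \<omega>))) \<partial>M)"
    using lim by (intro nn_integral_cong lim_imp_Liminf[symmetric]) auto
  also have "\<dots> \<le> liminf (\<lambda>n. \<integral>\<^sup>+ \<omega>. ennreal (I n \<omega> * (W \<omega> * Z \<omega>)) \<partial>M)"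
    by (intro nn_integral_liminf) measurable
  also have "\<dots> \<le> liminf (\<lambda>n. \<integral>\<^sup>+ \<omega>. ennreal (W \<omega>) \<partial>M)"
    using bounded_step by (intro Liminf_mono) auto
  also have "\<dots> = (\<integral>\<^sup>+ \<omega>. ennreal (W \<omega>) \<partial>M)"
    by (intro Liminf_const) simp
  finally show "(\<integral>\<^sup>+ \<omega>. ennreal (W \<omega> * Z \<omega>) \<partial>M) \<le> (\<integral>\<^sup>+ \<omega>. ennreal (W \<omega>) \<partial>M)" .
qed

end

section \<open>Measurability of the statistics\<close>

lemma mu_hat_measurable:
  assumes "\<And>i. i \<in> {1..<t} \<Longrightarrow> x i \<in> borel_measurable N"
    and "\<And>i. i \<in> {1..<t} \<Longrightarrow> lt i \<in> borel_measurable N"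
  shows "(\<lambda>\<omega>. mu_hat (\<lambda>i. x i \<omega>) (\<lambda>i. lt i \<omega>) t) \<in> borel_measurable N"
proof -
  have [measurable]: "(\<lambda>\<omega>. \<Sum>i\<in>{1..<t}. lt i \<omega>) \<in> borel_measurable N"
    "(\<lambda>\<omega>. \<Sum>i\<in>{1..<t}. lt i \<omega> * x i \<omega>) \<in> borel_measurable N"
    using assms by (auto intro!: borel_measurable_sum borel_measurable_times)
  show ?thesis
    unfolding mu_hat_def by measurable
qed

lemma C_tilde_measurable:
  assumes "\<And>i. i \<in> {1..<t} \<Longrightarrow> lt i \<in> borel_measurable N"
  shows "(\<lambda>\<omega>. C2_tilde (\<lambda>i. lt i \<omega>) t) \<in> borel_measurable N"
    and "(\<lambda>\<omega>. C1_tilde (\<lambda>i. lt i \<omega>) \<delta> t) \<in> borel_measurable N"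
    and "(\<lambda>\<omega>. C0_tilde (\<lambda>i. lt i \<omega>) \<delta> t) \<in> borel_measurable N"
proof -
  have psi: "psi_P \<in> borel_measurable borel"
    unfolding psi_P_def by measurable
  have [measurable]: "(\<lambda>\<omega>. \<Sum>i\<in>{1..<t}. lt i \<omega>) \<in> borel_measurable N"
    "(\<lambda>\<omega>. \<Sum>i\<in>{1..<t}. psi_P (lt i \<omega>)) \<in> borel_measurable N"
    using assms by (auto intro!: borel_measurable_sum measurable_compose[OF _ psi])
  show "(\<lambda>\<omega>. C2_tilde (\<lambda>i. lt i \<omega>) t) \<in> borel_measurable N"
    unfolding C2_tilde_def by measurable
  show "(\<lambda>\<omega>. C1_tilde (\<lambda>i. lt i \<omega>) \<delta> t) \<in> borel_measurable N"
    unfolding C1_tilde_def by measurable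
  show "(\<lambda>\<omega>. C0_tilde (\<lambda>i. lt i \<omega>) \<delta> t) \<in> borel_measurable N"
    unfolding C0_tilde_def by measurable
qed

lemma L_bound_measurable:
  assumes x: "\<And>i. i \<ge> 1 \<Longrightarrow> x i \<in> borel_measurable N"
    and s: "\<And>i. i \<ge> 1 \<Longrightarrow> s i \<in> borel_measurable N"
    and l: "\<And>i. i \<ge> 1 \<Longrightarrow> l i \<in> borel_measurable N"
    and lt: "\<And>i. i \<ge> 1 \<Longrightarrow> lt i \<in> borel_measurable N"
  shows "(\<lambda>\<omega>. L_bound \<alpha>1 \<alpha>2 (\<lambda>i. x i \<omega>) (\<lambda>i. s i \<omega>) (\<lambda>i. l i \<omega>) (\<lambda>i. lt i \<omega>) t)
    \<in> borel_measurable N"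
proof -
  have m: "(\<lambda>\<omega>. mu_hat (\<lambda>i. x i \<omega>) (\<lambda>i. lt i \<omega>) i) \<in> borel_measurable N" for i
    using x lt by (intro mu_hat_measurable) auto
  have Ct: "(\<lambda>\<omega>. C2_tilde (\<lambda>i. lt i \<omega>) i) \<in> borel_measurable N"
    "(\<lambda>\<omega>. C1_tilde (\<lambda>i. lt i \<omega>) \<alpha>1 i) \<in> borel_measurable N"
    "(\<lambda>\<omega>. C0_tilde (\<lambda>i. lt i \<omega>) \<alpha>1 i) \<in> borel_measurable N" for i
    using lt by (auto intro!: C_tilde_measurable)
  have psi: "psi_E \<in> borel_measurable borel"
    unfolding psi_E_def by measurable
  have [measurable]:
    "(\<lambda>\<omega>. \<Sum>i\<in>{1..t}. l i \<omega>) \<in> borel_measurable N"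
    "(\<lambda>\<omega>. \<Sum>i\<in>{1..t}. l i \<omega> * (x i \<omega> - mu_hat (\<lambda>i. x i \<omega>) (\<lambda>i. lt i \<omega>) i)\<^sup>2) \<in> borel_measurable N"
    "(\<lambda>\<omega>. \<Sum>i\<in>{1..t}. psi_E (l i \<omega>)
        * ((x i \<omega> - mu_hat (\<lambda>i. x i \<omega>) (\<lambda>i. lt i \<omega>) i)\<^sup>2 - s i \<omega>)\<^sup>2) \<in> borel_measurable N"
    "(\<lambda>\<omega>. \<Sum>i\<in>{1..t}. l i \<omega> * C2_tilde (\<lambda>i. lt i \<omega>) i) \<in> borel_measurable N"
    "(\<lambda>\<omega>. \<Sum>i\<in>{1..t}. l i \<omega> * C1_tilde (\<lambda>i. lt i \<omega>) \<alpha>1 i) \<in> borel_measurable N"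
    "(\<lambda>\<omega>. \<Sum>i\<in>{1..t}. l i \<omega> * C0_tilde (\<lambda>i. lt i \<omega>) \<alpha>1 i) \<in> borel_measurable N"
    using x s l m Ct
    by (auto intro!: borel_measurable_sum borel_measurable_times borel_measurable_power
        borel_measurable_diff measurable_compose[OF _ psi])
  have [measurable]: "(\<lambda>\<omega>. C2 (\<lambda>i. l i \<omega>) (\<lambda>i. lt i \<omega>) t) \<in> borel_measurable N"
    unfolding C2_def by measurable
  have [measurable]: "(\<lambda>\<omega>. C1 (\<lambda>i. l i \<omega>) (\<lambda>i. lt i \<omega>) \<alpha>1 t) \<in> borel_measurable N"
    unfolding C1_def by measurable
  have [measurable]: "(\<lambda>\<omega>. L_radicand \<alpha>1 \<alpha>2 (\<lambda>i. x i \<omega>) (\<lambda>i. s i \<omega>) (\<lambda>i. l i \<omega>) (\<lambda>i. lt i \<omega>) t)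
      \<in> borel_measurable N"
    unfolding L_radicand_def D_stat_def R_stat_def C0_def by measurable
  show ?thesis
    unfolding L_bound_def by measurable
qed

section \<open>Deviation bounds\<close>

context constant_moments
begin

lemma predictableD:
  assumes "predictable F Y" "t \<ge> 1"
  shows "Y t \<in> borel_measurable (F (t - 1))"
  using assms by (auto simp: predictable_def)

text \<open>
  Bennett's bound, uniformly in time; \<open>s\<close> selects the upper or the lower tail. By
  \<open>exp_mult_le_psi_P\<close> the exponential factor is dominated by
  \<open>exp (- psi_P lt v) * (1 + lt s (X - \<mu>) + psi_P lt (X - \<mu>)\<^sup>2)\<close>, and the conditional mean of this
  bound is \<open>exp (- u) * (1 + u) \<le> 1\<close> with \<open>u = psi_P lt v\<close>.
\<close>

lemma mean_deviation:
  assumes lt: "predictable F lt" and lt0: "\<And>i. i \<ge> 1 \<Longrightarrow> AE \<omega> in M. lt i \<omega> \<in> {0..}"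
    and s: "\<bar>s\<bar> = 1" and \<delta>: "\<delta> > 0"
  defines "E \<equiv> {\<omega> \<in> space M. \<exists>t. ln (1 / \<delta>)
      \<le> (\<Sum>i\<in>{1..t}. lt i \<omega> * (s * (X i \<omega> - \<mu>)) - psi_P (lt i \<omega>) * v)}"
  shows "E \<in> events" "prob E \<le> \<delta>"
proof -
  let ?U = "\<lambda>i \<omega>. lt i \<omega> * (s * (X i \<omega> - \<mu>)) - psi_P (lt i \<omega>) * v"
  have meas: "?U t \<in> borel_measurable (F t)" if t: "t \<ge> 1" for t
  proof -
    note [measurable] = X_adapted[OF t order_refl]
      F_measurable_mono[OF predictableD[OF lt t], of t, simplified]
    show ?thesis
      unfolding psi_P_def by measurable
  qed
  have step: "cond_exp_le_one M (F (t - 1)) (\<lambda>\<omega>. exp (?U t \<omega>))" if t: "t \<ge> 1" for t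
  proof -
    note ltF = predictableD[OF lt t]
    define A where "A \<omega> = exp (- (psi_P (lt t \<omega>) * v))" for \<omega>
    have A: "A \<in> borel_measurable (F (t - 1))"
      unfolding A_def psi_P_def using ltF by measurable
    have psi: "(\<lambda>\<omega>. psi_P (lt t \<omega>)) \<in> borel_measurable (F (t - 1))"
      unfolding psi_P_def using ltF by measurable
    show ?thesis
    proof (rule cond_exp_le_one_of_quadratic_bound[where A = A
          and B = "\<lambda>\<omega>. A \<omega> * (lt t \<omega> * s)" and C = "\<lambda>\<omega>. A \<omega> * psi_P (lt t \<omega>)", OF t A])
      show "(\<lambda>\<omega>. A \<omega> * (lt t \<omega> * s)) \<in> borel_measurable (F (t - 1))"
        "(\<lambda>\<omega>. A \<omega> * psi_P (lt t \<omega>)) \<in> borel_measurable (F (t - 1))"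
        using A ltF psi by measurable
      show "(\<lambda>\<omega>. exp (?U t \<omega>)) \<in> borel_measurable M"
        using F_measurable[OF meas[OF t]] by measurable
      show "AE \<omega> in M. exp (?U t \<omega>)
          \<le> A \<omega> + A \<omega> * (lt t \<omega> * s) * (X t \<omega> - \<mu>) + A \<omega> * psi_P (lt t \<omega>) * (X t \<omega> - \<mu>)\<^sup>2"
        using lt0[OF t] X_centred_bound[OF t]
      proof eventually_elim
        case (elim \<omega>)
        have "s\<^sup>2 = 1"
          using s by (metis power2_abs one_power2)
        then have sq: "(s * (X t \<omega> - \<mu>))\<^sup>2 = (X t \<omega> - \<mu>)\<^sup>2"
          by (simp add: power_mult_distrib)
        have "exp (?U t \<omega>) = A \<omega> * exp (lt t \<omega> * (s * (X t \<omega> - \<mu>)))"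
          by (simp add: A_def exp_add[symmetric])
        also have "\<dots> \<le> A \<omega> * (1 + lt t \<omega> * (s * (X t \<omega> - \<mu>))
            + psi_P (lt t \<omega>) * (s * (X t \<omega> - \<mu>))\<^sup>2)"
          using elim s by (intro mult_left_mono exp_mult_le_psi_P) (auto simp: abs_mult A_def)
        finally show ?case
          unfolding sq by (simp add: algebra_simps)
      qed
      show "AE \<omega> in M. A \<omega> + A \<omega> * psi_P (lt t \<omega>) * v \<le> 1"
      proof (rule AE_I2)
        fix \<omega>
        have "A \<omega> * (1 + psi_P (lt t \<omega>) * v) \<le> A \<omega> * exp (psi_P (lt t \<omega>) * v)"
          by (intro mult_left_mono exp_ge_add_one_self) (simp add: A_def)
        also have "\<dots> = 1"
          by (simp add: A_def exp_add[symmetric])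
        finally show "A \<omega> + A \<omega> * psi_P (lt t \<omega>) * v \<le> 1"
          by (simp add: algebra_simps)
      qed
    qed simp
  qed
  note v = ville_exp[of F ?U \<delta>, OF F_subalgebra F_mono meas step \<delta>]
  show "E \<in> events"
    unfolding E_def by (rule v(1))
  show "prob E \<le> \<delta>"
    unfolding E_def by (rule v(2))
qed

text \<open>
  The empirical Bernstein bound for the squared residuals around a predictable centre \<open>m\<close>. With
  \<open>\<xi> = (X - m)\<^sup>2 - s\<close>, which lies in \<open>[-1, 1]\<close>, and \<open>u = l * E[\<xi> | F] = l * (v + (m - \<mu>)\<^sup>2 - s)\<close>, the
  factor equals \<open>exp (- u) * exp (l \<xi> - psi_E l \<xi>\<^sup>2)\<close>. By \<open>exp_minus_psi_E_le\<close> it is at most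
  \<open>exp (- u) * (1 + l \<xi>)\<close>, whose conditional mean is \<open>exp (- u) * (1 + u) \<le> 1\<close>. The predictions \<open>s\<close>
  cancel from the linear part and survive only in the correction term.
\<close>

lemma square_deviation:
  assumes m: "predictable F m" and m01: "\<And>i. i \<ge> 1 \<Longrightarrow> AE \<omega> in M. m i \<omega> \<in> {0..1}"
    and s: "predictable F s" and s01: "\<And>i. i \<ge> 1 \<Longrightarrow> AE \<omega> in M. s i \<omega> \<in> {0..1}"
    and l: "predictable F l" and l01: "\<And>i. i \<ge> 1 \<Longrightarrow> AE \<omega> in M. l i \<omega> \<in> {0..<1}"
    and \<delta>: "\<delta> > 0"
  defines "E \<equiv> {\<omega> \<in> space M. \<exists>t. ln (1 / \<delta>)
      \<le> (\<Sum>i\<in>{1..t}. l i \<omega> * ((X i \<omega> - m i \<omega>)\<^sup>2 - (v + (m i \<omega> - \<mu>)\<^sup>2))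
            - psi_E (l i \<omega>) * ((X i \<omega> - m i \<omega>)\<^sup>2 - s i \<omega>)\<^sup>2)}"
  shows "E \<in> events" "prob E \<le> \<delta>"
proof -
  let ?U = "\<lambda>i \<omega>. l i \<omega> * ((X i \<omega> - m i \<omega>)\<^sup>2 - (v + (m i \<omega> - \<mu>)\<^sup>2))
    - psi_E (l i \<omega>) * ((X i \<omega> - m i \<omega>)\<^sup>2 - s i \<omega>)\<^sup>2"
  have meas: "?U t \<in> borel_measurable (F t)" if t: "t \<ge> 1" for t
  proof -
    note [measurable] = X_adapted[OF t order_refl]
      F_measurable_mono[OF predictableD[OF m t], of t, simplified]
      F_measurable_mono[OF predictableD[OF s t], of t, simplified]
      F_measurable_mono[OF predictableD[OF l t], of t, simplified]
    show ?thesis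
      unfolding psi_E_def by measurable
  qed
  have step: "cond_exp_le_one M (F (t - 1)) (\<lambda>\<omega>. exp (?U t \<omega>))" if t: "t \<ge> 1" for t
  proof -
    note pF = predictableD[OF m t] predictableD[OF s t] predictableD[OF l t]
    define k where "k \<omega> = exp (- (l t \<omega> * (v + (m t \<omega> - \<mu>)\<^sup>2 - s t \<omega>)))" for \<omega>
    have k: "k \<in> borel_measurable (F (t - 1))"
      unfolding k_def using pF by measurable
    show ?thesis
    proof (rule cond_exp_le_one_of_quadratic_bound[
          where A = "\<lambda>\<omega>. k \<omega> * (1 + l t \<omega> * ((m t \<omega> - \<mu>)\<^sup>2 - s t \<omega>))"
          and B = "\<lambda>\<omega>. k \<omega> * (2 * l t \<omega> * (\<mu> - m t \<omega>))" and C = "\<lambda>\<omega>. k \<omega> * l t \<omega>", OF t])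
      \<comment> \<open>The coefficients come from expanding \<open>k * (1 + l \<xi>)\<close> in powers of \<open>X - \<mu>\<close>, by means of
        \<open>(X - m)\<^sup>2 = (X - \<mu>)\<^sup>2 + 2 (\<mu> - m) (X - \<mu>) + (m - \<mu>)\<^sup>2\<close>.\<close>
      show "(\<lambda>\<omega>. k \<omega> * (1 + l t \<omega> * ((m t \<omega> - \<mu>)\<^sup>2 - s t \<omega>))) \<in> borel_measurable (F (t - 1))"
        "(\<lambda>\<omega>. k \<omega> * (2 * l t \<omega> * (\<mu> - m t \<omega>))) \<in> borel_measurable (F (t - 1))"
        "(\<lambda>\<omega>. k \<omega> * l t \<omega>) \<in> borel_measurable (F (t - 1))"
        using k pF by measurable
      show "(\<lambda>\<omega>. exp (?U t \<omega>)) \<in> borel_measurable M"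
        using F_measurable[OF meas[OF t]] by measurable
      show "AE \<omega> in M. exp (?U t \<omega>)
          \<le> k \<omega> * (1 + l t \<omega> * ((m t \<omega> - \<mu>)\<^sup>2 - s t \<omega>))
            + k \<omega> * (2 * l t \<omega> * (\<mu> - m t \<omega>)) * (X t \<omega> - \<mu>) + k \<omega> * l t \<omega> * (X t \<omega> - \<mu>)\<^sup>2"
        using m01[OF t] s01[OF t] l01[OF t] X_unit[OF t]
      proof eventually_elim
        case (elim \<omega>)
        let ?\<xi> = "(X t \<omega> - m t \<omega>)\<^sup>2 - s t \<omega>"
        have "\<bar>X t \<omega> - m t \<omega>\<bar> \<le> 1"
          using elim by (auto simp: abs_le_iff)
        then have "(X t \<omega> - m t \<omega>)\<^sup>2 \<le> 1"
          by (simp add: abs_square_le_1)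
        then have \<xi>: "\<bar>?\<xi>\<bar> \<le> 1"
          using elim zero_le_power2[of "X t \<omega> - m t \<omega>"] unfolding abs_le_iff atLeastAtMost_iff
          by linarith
        have "exp (?U t \<omega>) = k \<omega> * exp (l t \<omega> * ?\<xi> - psi_E (l t \<omega>) * ?\<xi>\<^sup>2)"
          unfolding k_def exp_add[symmetric] by (simp add: algebra_simps)
        also have "\<dots> \<le> k \<omega> * (1 + l t \<omega> * ?\<xi>)"
          using elim \<xi> by (intro mult_left_mono exp_minus_psi_E_le) (auto simp: k_def)
        also have "\<dots> = k \<omega> * (1 + l t \<omega> * ((m t \<omega> - \<mu>)\<^sup>2 - s t \<omega>))
            + k \<omega> * (2 * l t \<omega> * (\<mu> - m t \<omega>)) * (X t \<omega> - \<mu>) + k \<omega> * l t \<omega> * (X t \<omega> - \<mu>)\<^sup>2"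
          by (simp add: power2_eq_square algebra_simps)
        finally show ?case .
      qed
      show "AE \<omega> in M. k \<omega> * (1 + l t \<omega> * ((m t \<omega> - \<mu>)\<^sup>2 - s t \<omega>)) + k \<omega> * l t \<omega> * v \<le> 1"
      proof (rule AE_I2)
        fix \<omega>
        let ?u = "l t \<omega> * (v + (m t \<omega> - \<mu>)\<^sup>2 - s t \<omega>)"
        have "k \<omega> * (1 + ?u) \<le> k \<omega> * exp ?u"
          by (intro mult_left_mono exp_ge_add_one_self) (simp add: k_def)
        also have "\<dots> = 1"
          unfolding k_def exp_add[symmetric] by simp
        finally show "k \<omega> * (1 + l t \<omega> * ((m t \<omega> - \<mu>)\<^sup>2 - s t \<omega>)) + k \<omega> * l t \<omega> * v \<le> 1"
          by (simp add: algebra_simps)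
      qed
    qed simp
  qed
  note v = ville_exp[of F ?U \<delta>, OF F_subalgebra F_mono meas step \<delta>]
  show "E \<in> events"
    unfolding E_def by (rule v(1))
  show "prob E \<le> \<delta>"
    unfolding E_def by (rule v(2))
qed

end

section \<open>Inverting the deviation bounds\<close>

lemma mu_hat_in_unit:
  assumes "\<And>i. i \<in> {1..<t} \<Longrightarrow> 0 \<le> lt i" and "\<And>i. i \<in> {1..<t} \<Longrightarrow> x i \<in> {0..1}"
  shows "mu_hat x lt t \<in> {0..1}"
proof (cases "t = 1 \<or> (\<Sum>i\<in>{1..<t}. lt i) = 0")
  case False
  have "(\<Sum>i\<in>{1..<t}. lt i) \<ge> 0" "(\<Sum>i\<in>{1..<t}. lt i * x i) \<ge> 0"
    using assms by (auto intro!: sum_nonneg)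
  moreover have "(\<Sum>i\<in>{1..<t}. lt i * x i) \<le> (\<Sum>i\<in>{1..<t}. lt i)"
    using assms by (intro sum_mono) (auto intro: mult_left_le)
  ultimately show ?thesis
    using False by (auto simp: mu_hat_def divide_le_eq_1)
qed (auto simp: mu_hat_def)

text \<open>
  The error of the weighted mean is the weighted sum of the centred observations divided by the total
  weight, so the coefficients arise by squaring the deviation bound. In the degenerate case the
  estimate is \<open>1 / 2\<close>, which is within \<open>1 / 2\<close> of every \<open>\<mu>\<close> in the unit interval.
\<close>

lemma mu_hat_error:
  assumes lt: "\<And>i. i \<in> {1..<t} \<Longrightarrow> 0 \<le> lt i" and \<mu>: "\<mu> \<in> {0..1}"
    and dev: "\<bar>\<Sum>i\<in>{1..<t}. lt i * (x i - \<mu>)\<bar> \<le> ln (2 / \<delta>) + v * (\<Sum>i\<in>{1..<t}. psi_P (lt i))"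
  shows "(mu_hat x lt t - \<mu>)\<^sup>2 \<le> C2_tilde lt t * v\<^sup>2 + C1_tilde lt \<delta> t * v + C0_tilde lt \<delta> t"
proof (cases "t = 1 \<or> (\<Sum>i\<in>{1..<t}. lt i) = 0")
  case True
  have "\<bar>1 / 2 - \<mu>\<bar> \<le> 1 / 2"
    using \<mu> unfolding abs_le_iff atLeastAtMost_iff by linarith
  then have "(1 / 2 - \<mu>)\<^sup>2 \<le> (1 / 2)\<^sup>2"
    by (simp add: abs_le_square_iff[symmetric])
  with True show ?thesis
    by (auto simp: mu_hat_def C2_tilde_def C1_tilde_def C0_tilde_def power2_eq_square)
next
  case False
  let ?S = "\<Sum>i\<in>{1..<t}. lt i" and ?P = "\<Sum>i\<in>{1..<t}. psi_P (lt i)"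
  have S: "?S > 0"
    using False lt by (metis less_eq_real_def sum_nonneg)
  have "(\<Sum>i\<in>{1..<t}. lt i * (x i - \<mu>)) = (\<Sum>i\<in>{1..<t}. lt i * x i) - ?S * \<mu>"
    by (simp add: right_diff_distrib sum_subtractf sum_distrib_right)
  then have "mu_hat x lt t - \<mu> = (\<Sum>i\<in>{1..<t}. lt i * (x i - \<mu>)) / ?S"
    using False by (simp add: mu_hat_def field_simps)
  then have "(mu_hat x lt t - \<mu>)\<^sup>2 = \<bar>\<Sum>i\<in>{1..<t}. lt i * (x i - \<mu>)\<bar>\<^sup>2 / ?S\<^sup>2"
    by (simp add: power_divide)
  also have "\<dots> \<le> (ln (2 / \<delta>) + v * ?P)\<^sup>2 / ?S\<^sup>2"
    using dev by (intro divide_right_mono power_mono) auto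
  also have "\<dots> = ?P\<^sup>2 / ?S\<^sup>2 * v\<^sup>2 + 2 * ln (2 / \<delta>) * ?P / ?S\<^sup>2 * v + (ln (2 / \<delta>))\<^sup>2 / ?S\<^sup>2"
    by (simp add: power2_eq_square algebra_simps add_divide_distrib)
  finally show ?thesis
    using False by (simp add: C2_tilde_def C1_tilde_def C0_tilde_def)
qed

lemma C_tilde_nonneg:
  assumes "0 < \<delta>" "\<delta> \<le> 2"
  shows "C2_tilde lt t \<ge> 0" "C1_tilde lt \<delta> t \<ge> 0"
  using assms
  by (auto simp: C2_tilde_def C1_tilde_def psi_P_nonneg sum_nonneg simp del: ln_div)

text \<open>
  As \<open>y\<close> is nonnegative and \<open>b\<close> positive, \<open>y\<close> lies to the right of the vertex \<open>- b / (2 * a)\<close> of the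
  parabola, where exceeding the level \<open>c\<close> means exceeding the larger root.
\<close>

lemma larger_root_less:
  fixes a b c y :: real
  assumes "a > 0" "b > 0" "y \<ge> 0" and q: "a * y\<^sup>2 + b * y > c"
  shows "(- b + sqrt (b\<^sup>2 + 4 * a * c)) / (2 * a) < y"
proof -
  have "4 * a * c < 4 * a * (a * y\<^sup>2 + b * y)"
    using assms(1) q by (intro mult_strict_left_mono) auto
  then have "b\<^sup>2 + 4 * a * c < (2 * a * y + b)\<^sup>2"
    by (simp add: power2_eq_square algebra_simps)
  then have "sqrt (b\<^sup>2 + 4 * a * c) < 2 * a * y + b"
    using assms(1-3) by (intro real_less_lsqrt) auto
  then show ?thesis
    using assms(1) by (simp add: divide_less_eq algebra_simps)
qed

text \<open>
  The deterministic core: inserting the bounds on the bias into the bound on the squared residuals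
  and dividing by the total weight yields \<open>D - C0 - R < C2 v\<^sup>2 + C1 v\<close>. The leading \<open>1\<close> in \<open>C1\<close> stems
  from the term \<open>v\<close> of the conditional mean \<open>v + (mu_hat - \<mu>)\<^sup>2\<close>.
\<close>

lemma L_bound_less:
  assumes l: "\<And>i. i \<in> {1..t} \<Longrightarrow> 0 \<le> l i" and v: "v \<ge> 0" and \<alpha>1: "0 < \<alpha>1" "\<alpha>1 \<le> 2"
    and err: "\<And>i. i \<in> {1..t} \<Longrightarrow> (mu_hat x lt i - \<mu>)\<^sup>2
        \<le> C2_tilde lt i * v\<^sup>2 + C1_tilde lt \<alpha>1 i * v + C0_tilde lt \<alpha>1 i"
    and dev: "(\<Sum>i\<in>{1..t}. l i * ((x i - mu_hat x lt i)\<^sup>2 - (v + (mu_hat x lt i - \<mu>)\<^sup>2))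
        - psi_E (l i) * ((x i - mu_hat x lt i)\<^sup>2 - s i)\<^sup>2) < ln (1 / \<alpha>2)"
  shows "L_bound \<alpha>1 \<alpha>2 x s l lt t < ereal v"
proof (cases "(\<Sum>i\<in>{1..t}. l i) = 0 \<or> C2 l lt t = 0 \<or> L_radicand \<alpha>1 \<alpha>2 x s l lt t < 0")
  case True
  then show ?thesis
    by (auto simp: L_bound_def)
next
  case False
  let ?S = "\<Sum>i\<in>{1..t}. l i"
  let ?R = "\<Sum>i\<in>{1..t}. psi_E (l i) * ((x i - mu_hat x lt i)\<^sup>2 - s i)\<^sup>2"
  have S: "?S > 0"
    using False l by (metis less_eq_real_def sum_nonneg)
  have C2: "C2 l lt t > 0"
    using False S l C_tilde_nonneg(1)[OF \<alpha>1]
    by (auto simp: C2_def less_le intro!: divide_nonneg_nonneg sum_nonneg)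
  have C1: "C1 l lt \<alpha>1 t > 0"
    using S l C_tilde_nonneg(2)[OF \<alpha>1]
    by (auto simp: C1_def intro!: add_pos_nonneg divide_nonneg_nonneg sum_nonneg)
  have "(\<Sum>i\<in>{1..t}. l i * (mu_hat x lt i - \<mu>)\<^sup>2)
      \<le> (\<Sum>i\<in>{1..t}. l i * (C2_tilde lt i * v\<^sup>2 + C1_tilde lt \<alpha>1 i * v + C0_tilde lt \<alpha>1 i))"
    using err l by (intro sum_mono mult_left_mono) auto
  also have "\<dots> = (\<Sum>i\<in>{1..t}. l i * C2_tilde lt i) * v\<^sup>2 + (\<Sum>i\<in>{1..t}. l i * C1_tilde lt \<alpha>1 i) * v
      + (\<Sum>i\<in>{1..t}. l i * C0_tilde lt \<alpha>1 i)"
    by (simp add: distrib_left sum.distrib sum_distrib_right mult.assoc)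
  finally have bias: "(\<Sum>i\<in>{1..t}. l i * (mu_hat x lt i - \<mu>)\<^sup>2) \<le> \<dots>" .
  have "(\<Sum>i\<in>{1..t}. l i * ((x i - mu_hat x lt i)\<^sup>2 - (v + (mu_hat x lt i - \<mu>)\<^sup>2))
        - psi_E (l i) * ((x i - mu_hat x lt i)\<^sup>2 - s i)\<^sup>2)
      = (\<Sum>i\<in>{1..t}. l i * (x i - mu_hat x lt i)\<^sup>2) - ?S * v
        - (\<Sum>i\<in>{1..t}. l i * (mu_hat x lt i - \<mu>)\<^sup>2) - ?R"
    by (simp add: right_diff_distrib distrib_left sum.distrib sum_subtractf sum_distrib_right)
  then have "(\<Sum>i\<in>{1..t}. l i * (x i - mu_hat x lt i)\<^sup>2)
      - (\<Sum>i\<in>{1..t}. l i * C0_tilde lt \<alpha>1 i) - (ln (1 / \<alpha>2) + ?R)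
      < (\<Sum>i\<in>{1..t}. l i * C2_tilde lt i) * v\<^sup>2
        + (?S + (\<Sum>i\<in>{1..t}. l i * C1_tilde lt \<alpha>1 i)) * v"
    using dev bias unfolding distrib_right by linarith
  then have "((\<Sum>i\<in>{1..t}. l i * (x i - mu_hat x lt i)\<^sup>2)
      - (\<Sum>i\<in>{1..t}. l i * C0_tilde lt \<alpha>1 i) - (ln (1 / \<alpha>2) + ?R)) / ?S
      < ((\<Sum>i\<in>{1..t}. l i * C2_tilde lt i) * v\<^sup>2
        + (?S + (\<Sum>i\<in>{1..t}. l i * C1_tilde lt \<alpha>1 i)) * v) / ?S"
    using S by (rule divide_strict_right_mono)
  then have "D_stat x l lt t - C0 l lt \<alpha>1 t - R_stat x s l lt \<alpha>2 t
      < C2 l lt t * v\<^sup>2 + C1 l lt \<alpha>1 t * v"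
    using S unfolding D_stat_def C0_def R_stat_def C2_def C1_def diff_divide_distrib
      add_divide_distrib by (simp add: add_divide_distrib distrib_right del: ln_div)
  from larger_root_less[OF C2 C1 v this] show ?thesis
    using False by (simp add: L_bound_def L_radicand_def)
qed

section \<open>The confidence sequence\<close>

theorem corollary4p4:
  fixes M :: "'a measure"
    and X :: "nat \<Rightarrow> 'a \<Rightarrow> real"
    and \<mu> \<sigma>2 \<alpha> \<alpha>1 \<alpha>2 :: real
    and \<sigma>2_hat lam lam_tilde :: "nat \<Rightarrow> 'a \<Rightarrow> real"
  assumes "prob_space M"
    and "\<And>t. t \<ge> 1 \<Longrightarrow> X t \<in> borel_measurable M"
    and "\<And>t. t \<ge> 1 \<Longrightarrow> AE \<omega> in M. X t \<omega> \<in> {0..1}"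
    and "\<And>t. t \<ge> 1 \<Longrightarrow>
           AE \<omega> in M. real_cond_exp M (canonical_filtration M X (t - 1)) (X t) \<omega> = \<mu>"
    and "\<And>t. t \<ge> 1 \<Longrightarrow>
           AE \<omega> in M. cond_var M (canonical_filtration M X (t - 1)) (X t) \<omega> = \<sigma>2"
    and "0 < \<alpha>" and "\<alpha> < 1"
    and "\<alpha>1 > 0" and "\<alpha>2 > 0" and "\<alpha>1 + \<alpha>2 = \<alpha>"
    and "predictable (canonical_filtration M X) \<sigma>2_hat"
    and "\<And>i. i \<ge> 1 \<Longrightarrow> AE \<omega> in M. \<sigma>2_hat i \<omega> \<in> {0..1}"
    and "predictable (canonical_filtration M X) lam"
    and "\<And>i. i \<ge> 1 \<Longrightarrow> AE \<omega> in M. lam i \<omega> \<in> {0..<1}"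
    and "predictable (canonical_filtration M X) lam_tilde"
    and "\<And>i. i \<ge> 1 \<Longrightarrow> AE \<omega> in M. lam_tilde i \<omega> \<in> {0..}"
  shows "confidence_sequence M \<alpha> \<sigma>2
           (\<lambda>t \<omega>. {y :: real. L_bound \<alpha>1 \<alpha>2 (\<lambda>i. X i \<omega>) (\<lambda>i. \<sigma>2_hat i \<omega>) (\<lambda>i. lam i \<omega>)
                              (\<lambda>i. lam_tilde i \<omega>) t < ereal y})"
proof -
  interpret constant_moments M X \<mu> \<sigma>2
    using assms(1-5) by (simp add: constant_moments_def constant_moments_axioms_def)
  note sig = assms(11,12) and lam = assms(13,14) and lt = assms(15,16)
  have \<alpha>1: "0 < \<alpha>1" "\<alpha>1 \<le> 2"
    using assms(6-10) by auto
  define m where "m i \<omega> = mu_hat (\<lambda>i. X i \<omega>) (\<lambda>i. lam_tilde i \<omega>) i" for i \<omega>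
  have AE_all: "AE \<omega> in M. \<forall>i\<ge>1. P i \<omega>" if "\<And>i. i \<ge> 1 \<Longrightarrow> AE \<omega> in M. P i \<omega>"
    for P :: "nat \<Rightarrow> 'a \<Rightarrow> bool"
    using that by (subst AE_all_countable) auto
  have AE_X: "AE \<omega> in M. \<forall>i\<ge>1. X i \<omega> \<in> {0..1}"
    by (rule AE_all) (rule assms(3))
  have AE_lam: "AE \<omega> in M. \<forall>i\<ge>1. lam i \<omega> \<in> {0..<1}"
    by (rule AE_all) (rule lam(2))
  have AE_lt: "AE \<omega> in M. \<forall>i\<ge>1. lam_tilde i \<omega> \<in> {0..}"
    by (rule AE_all) (rule lt(2))
  have m_pred: "predictable F m"
    unfolding predictable_def
  proof (intro allI impI)
    fix t :: nat assume "t \<ge> 1"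
    have "lam_tilde i \<in> borel_measurable (F (t - 1))" if "i \<in> {1..<t}" for i
      using that by (intro F_measurable_mono[OF predictableD[OF lt(1)]]) auto
    then show "m t \<in> borel_measurable (F (t - 1))"
      unfolding m_def by (intro mu_hat_measurable X_adapted) auto
  qed
  have m01: "AE \<omega> in M. m i \<omega> \<in> {0..1}" for i
    using AE_X AE_lt
  proof eventually_elim
    case (elim \<omega>)
    then show ?case
      unfolding m_def by (intro mu_hat_in_unit) simp_all
  qed
  let ?dev = "\<lambda>s \<omega> i. lam_tilde i \<omega> * (s * (X i \<omega> - \<mu>)) - psi_P (lam_tilde i \<omega>) * \<sigma>2"
  let ?sqdev = "\<lambda>\<omega> i. lam i \<omega> * ((X i \<omega> - m i \<omega>)\<^sup>2 - (\<sigma>2 + (m i \<omega> - \<mu>)\<^sup>2))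
    - psi_E (lam i \<omega>) * ((X i \<omega> - m i \<omega>)\<^sup>2 - \<sigma>2_hat i \<omega>)\<^sup>2"
  define E where "E s = {\<omega> \<in> space M. \<exists>t. ln (1 / (\<alpha>1 / 2)) \<le> (\<Sum>i\<in>{1..t}. ?dev s \<omega> i)}" for s :: real
  define E' where "E' = {\<omega> \<in> space M. \<exists>t. ln (1 / \<alpha>2) \<le> (\<Sum>i\<in>{1..t}. ?sqdev \<omega> i)}"
  have E: "E s \<in> events" "prob (E s) \<le> \<alpha>1 / 2" if "\<bar>s\<bar> = 1" for s
  proof -
    have "\<alpha>1 / 2 > 0"
      using \<alpha>1 by simp
    note dev = mean_deviation[OF lt that this]
    show "E s \<in> events"
      unfolding E_def by (rule dev(1))
    show "prob (E s) \<le> \<alpha>1 / 2"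
      unfolding E_def by (rule dev(2))
  qed
  note sqdev = square_deviation[OF m_pred m01 sig lam assms(9)]
  have E'_events: "E' \<in> events"
    unfolding E'_def by (rule sqdev(1))
  have E'_prob: "prob E' \<le> \<alpha>2"
    unfolding E'_def by (rule sqdev(2))
  \<comment> \<open>The exceptional set: \<open>\<alpha>1\<close> is split equally between the two tails of the mean estimate.\<close>
  define B where "B = (E 1 \<union> E (- 1)) \<union> E'"
  have B: "B \<in> events"
    unfolding B_def using E E'_events by auto
  have "prob B \<le> (prob (E 1) + prob (E (- 1))) + prob E'"
    unfolding B_def using E(1)[of 1] E(1)[of "- 1"] E'_events
    by (intro order_trans[OF measure_Un_le] add_mono order_refl) auto
  also have "\<dots> \<le> \<alpha>"
    using E(2)[of 1] E(2)[of "- 1"] E'_prob assms(10) by simp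
  finally have prob_B: "prob B \<le> \<alpha>" .
  let ?L = "\<lambda>t \<omega>. L_bound \<alpha>1 \<alpha>2 (\<lambda>i. X i \<omega>) (\<lambda>i. \<sigma>2_hat i \<omega>) (\<lambda>i. lam i \<omega>) (\<lambda>i. lam_tilde i \<omega>) t"
  let ?good = "{\<omega> \<in> space M. \<forall>t\<ge>1. ?L t \<omega> < ereal \<sigma>2}"
  have cover: "AE \<omega> in M. \<omega> \<in> space M - B \<longrightarrow> \<omega> \<in> ?good"
    using AE_X AE_lam AE_lt AE_space
  proof eventually_elim
    case (elim \<omega>)
    show ?case
    proof (intro impI CollectI conjI allI elim(4))
      fix t :: nat assume notB: "\<omega> \<in> space M - B" and "t \<ge> 1"
      have lt0: "0 \<le> lam_tilde i \<omega>" if "i \<ge> 1" for i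
        using elim(3) that by auto
      have dev: "s * (\<Sum>i\<in>{1..t}. lam_tilde i \<omega> * (X i \<omega> - \<mu>))
          < ln (2 / \<alpha>1) + \<sigma>2 * (\<Sum>i\<in>{1..t}. psi_P (lam_tilde i \<omega>))" if "s \<in> {1, - 1}" for s t
      proof -
        have "\<omega> \<notin> E s"
          using notB that by (auto simp: B_def)
        then have "(\<Sum>i\<in>{1..t}. ?dev s \<omega> i) < ln (2 / \<alpha>1)"
          using elim(4) by (auto simp: E_def not_le simp del: ln_div)
        moreover have "(\<Sum>i\<in>{1..t}. ?dev s \<omega> i)
            = s * (\<Sum>i\<in>{1..t}. lam_tilde i \<omega> * (X i \<omega> - \<mu>)) - \<sigma>2 * (\<Sum>i\<in>{1..t}. psi_P (lam_tilde i \<omega>))"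
          by (simp add: sum_subtractf sum_distrib_left mult_ac)
        ultimately show ?thesis
          by linarith
      qed
      have err: "(m i \<omega> - \<mu>)\<^sup>2 \<le> C2_tilde (\<lambda>i. lam_tilde i \<omega>) i * \<sigma>2\<^sup>2
          + C1_tilde (\<lambda>i. lam_tilde i \<omega>) \<alpha>1 i * \<sigma>2 + C0_tilde (\<lambda>i. lam_tilde i \<omega>) \<alpha>1 i"
        if "i \<in> {1..t}" for i
        unfolding m_def
      proof (rule mu_hat_error[OF _ mean_in_unit])
        \<comment> \<open>The estimate at time \<open>i\<close> uses the observations before \<open>i\<close>, hence the bound at time \<open>i - 1\<close>.\<close>
        have "{1..<i} = {1..i - 1}"
          using that by auto
        then show "\<bar>\<Sum>j\<in>{1..<i}. lam_tilde j \<omega> * (X j \<omega> - \<mu>)\<bar>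
            \<le> ln (2 / \<alpha>1) + \<sigma>2 * (\<Sum>j\<in>{1..<i}. psi_P (lam_tilde j \<omega>))"
          using dev[of 1 "i - 1"] dev[of "- 1" "i - 1"] unfolding abs_le_iff by simp
      qed (use lt0 in auto)
      have "\<omega> \<notin> E'"
        using notB by (simp add: B_def)
      then have "(\<Sum>i\<in>{1..t}. ?sqdev \<omega> i) < ln (1 / \<alpha>2)"
        using elim(4) by (auto simp: E'_def not_le simp del: ln_div)
      then show "?L t \<omega> < ereal \<sigma>2"
        using elim(2) \<alpha>1 variance_nonneg err unfolding m_def
        by (intro L_bound_less[where \<mu> = \<mu>]) simp_all
    qed
  qed
  have good: "?good \<in> events"
  proof -
    have pM: "Y i \<in> borel_measurable M" if "predictable F Y" "i \<ge> 1" for Y i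
      using F_measurable[OF predictableD[OF that]] .
    have [measurable]: "?L t \<in> borel_measurable M" for t
      by (rule L_bound_measurable[OF assms(2) pM[OF sig(1)] pM[OF lam(1)] pM[OF lt(1)]])
    have "?good = space M \<inter> (\<Inter>t\<in>{1..}. {\<omega> \<in> space M. ?L t \<omega> < ereal \<sigma>2})"
      by auto
    also have "\<dots> \<in> events"
      by (intro sets.Int sets.countable_INT') (auto intro: countable_subset)
    finally show ?thesis .
  qed
  have "1 - \<alpha> \<le> prob (space M - B)"
    using prob_B prob_compl[OF B] by simp
  also have "\<dots> \<le> prob ?good"
    by (rule finite_measure_mono_AE[OF cover good])
  finally show ?thesis
    by (simp add: confidence_sequence_def)
qed

end
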